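(* Let $f:\mathbb{R}^d\to\mathbb{R}$ be convex and $T:\mathbb{R}^d\to\mathbb{R}^d$ firmly nonexpansive with $\mathrm{Fix}\,T\neq\emptyset$, and assume that the solution set $\mathcal{S}$ of the problem of minimizing $f$ over $\mathrm{Fix}\,T$ is nonempty, with optimal value $f^*$. Let $a\in(0,1)$, let $\tau\in\mathbb{N}_0$, and let $\{\tau_n\}_{n=0}^\infty\subset\mathbb{N}_0$ satisfy $0\le\tau_n\le\tau$ for all $n\in\mathbb{N}_0$. Let $\{\alpha_n\}_{n=0}^\infty\subset(0,\infty)$ be nonincreasing with $(3+2(\tau+1)^2)\alpha_0^a<8$. Let $\{\mathbf{x}_n\}$ be generated by the Fixed-Point Delayed Subgradient Method: $\mathbf{x}_0=\mathbf{x}_{-1}=\cdots=\mathbf{x}_{-\tau}\in\mathbb{R}^d$ and $$\mathbf{x}_{n+1}=T\mathbf{x}_n-\alpha_n\widetilde{\nabla}f(T\mathbf{x}_{n-\tau_n}),\qquad n\in\mathbb{N}_0.$$ Suppose that there is $C>0$ with $\max\{\|\widetilde{\nabla}f(\mathbf{x}_n)\|,\|\widetilde{\nabla}f(T\mathbf{x}_n)\|\}\le C$ for all $n\in\mathbb{N}_0$. Then, for all $N\in\mathbb{N}_0$ and all $\mathbf{x}^*\in\mathcal{S}$, $$\min_{0\le n\le N}f(\mathbf{x}_{n+1})-f^*\le\frac{\|\mathbf{x}_0-\mathbf{x}^*\|^2+2C^2\sum_{n=0}^N\alpha_n^2+40C^2\sum_{n=0}^N\alpha_n^{2-a}}{2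\sum_{n=0}^N\alpha_n}.$$
   Context: $\mathbb{R}^d$ is Euclidean space with inner product $\langle\cdot,\cdot\rangle$ and induced norm $\|\cdot\|$; $\mathbb{N}_0$ is the set of nonnegative integers. $T$ is firmly nonexpansive if $\langle T\mathbf{x}-T\mathbf{y},\mathbf{x}-\mathbf{y}\rangle\ge\|T\mathbf{x}-T\mathbf{y}\|^2$ for all $\mathbf{x},\mathbf{y}\in\mathbb{R}^d$. $\mathrm{Fix}\,T=\{\mathbf{x}\in\mathbb{R}^d:T\mathbf{x}=\mathbf{x}\}$. $\mathcal{S}$ is the set of minimizers of $f$ over $\mathrm{Fix}\,T$ and $f^*$ is the minimum value. For each $\mathbf{x}\in\mathbb{R}^d$, $\widetilde{\nabla}f(\mathbf{x})$ denotes a (chosen) subgradient of $f$ at $\mathbf{x}$, i.e. an element of $\partial f(\mathbf{x})=\{\mathbf{g}\in\mathbb{R}^d:\langle\mathbf{g},\mathbf{y}-\mathbf{x}\rangle\le f(\mathbf{y})-f(\mathbf{x})\ \forall\mathbf{y}\in\mathbb{R}^d\}$. *)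

theory Defs
  imports "HOL-Analysis.Analysis"
begin

definition firmly_nonexpansive :: "('a::real_inner \<Rightarrow> 'a) \<Rightarrow> bool" where
  "firmly_nonexpansive T \<longleftrightarrow>
     (\<forall>x y. (T x - T y) \<bullet> (x - y) \<ge> (norm (T x - T y))\<^sup>2)"

definition Fix :: "('a \<Rightarrow> 'a) \<Rightarrow> 'a set" where
  "Fix T = {x. T x = x}"

definition subdifferential :: "('a::real_inner \<Rightarrow> real) \<Rightarrow> 'a \<Rightarrow> 'a set" where
  "subdifferential f x = {g. \<forall>y. g \<bullet> (y - x) \<le> f y - f x}"

definition solution_set :: "('a \<Rightarrow> real) \<Rightarrow> ('a \<Rightarrow> 'a) \<Rightarrow> 'a set" where
  "solution_set f T = {x. is_arg_min f (\<lambda>y. y \<in> Fix T) x}"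

text \<open>This is the minimum value of f over Fix T whenever solution_set f T is nonempty;
  otherwise it carries no meaning.\<close>

definition optimal_value :: "('a \<Rightarrow> real) \<Rightarrow> ('a \<Rightarrow> 'a) \<Rightarrow> real" where
  "optimal_value f T = (INF x\<in>Fix T. f x)"

text \<open>The fixed-point delayed subgradient method with maximal delay t, delays d,
  step sizes \<alpha> and chosen subgradients g. The iterates are indexed by integers because the
  initial values occupy the indices -t, ..., 0; values at indices below -t are
  unconstrained and are never used when all delays are at most t.\<close>

definition fp_delayed_subgradient ::
  "('a::real_vector \<Rightarrow> 'a) \<Rightarrow> ('a \<Rightarrow> 'a) \<Rightarrow> nat \<Rightarrow> (nat \<Rightarrow> nat) \<Rightarrow> (nat \<Rightarrow> real) \<Rightarrow> (int \<Rightarrow> 'a) \<Rightarrow> bool"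
  where
  "fp_delayed_subgradient T g t d \<alpha> x \<longleftrightarrow>
     (\<forall>k\<in>{- int t..0}. x k = x 0) \<and>
     (\<forall>n::nat. x (int n + 1) = T (x (int n)) - \<alpha> n *\<^sub>R g (T (x (int n - int (d n)))))"

end

theory Submission
  imports Defs
begin

text \<open>
  Put \<open>h n\<close> for the subgradient used in step \<open>n\<close>, \<open>r n = \<parallel>T (x n) - x n\<parallel>\<close> and \<open>L = \<tau> + 1\<close>.
  Expanding \<open>\<parallel>x (n + 1) - p\<parallel>\<^sup>2\<close> for a solution \<open>p\<close> gives the usual subgradient inequality with
  an error of order \<open>(\<alpha> n)\<^sup>2\<close>, except that \<open>h n\<close> was computed at the outdated point \<open>T (x m)\<close> with
  \<open>n - \<tau> \<le> m \<le> n\<close>, while the objective gap is wanted at \<open>x (n + 1)\<close>. The price is an additional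
  error \<open>4 C \<alpha> n \<parallel>T (x n) - T (x m)\<parallel>\<close> (lemma \<open>outdated_subgradient_step\<close>). In return, firm
  nonexpansiveness provides an extra decrease \<open>- (r n)\<^sup>2\<close> in each step.

  The additional error is paid for by that decrease. Since \<open>T\<close> is nonexpansive, \<open>\<parallel>T (x n) - T (x m)\<parallel>\<close> is at
  most the sum of \<open>r k + C \<alpha> k\<close> over the at most \<open>\<tau>\<close> indices \<open>k\<close> between \<open>m\<close> and \<open>n\<close>, and
  Young's inequality with weight \<open>1 / L\<close> turns each term into a multiple \<open>1 / L\<close> of \<open>(r k)\<^sup>2\<close> plus
  squared step sizes. After summation over \<open>n\<close> every \<open>k\<close> has been charged at most \<open>\<tau> \<le> L\<close> times
  (lemma \<open>sum_over_trailing_windows_le\<close>), so the extra decreases cover all the \<open>(r k)\<^sup>2\<close>, and what remains is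
  \<open>C\<^sup>2 (4 L\<^sup>2 + 4 L + 3)\<close> times the sum of the squared step sizes
  (lemma \<open>summed_objective_gap_le\<close>). The step size condition keeps \<open>L\<^sup>2\<close> below a constant
  multiple of \<open>\<alpha> 0 powr (- a)\<close>. It allows all but two units of that coefficient to be
  traded for the factor \<open>40\<close> and the smaller exponent \<open>2 - a\<close>
  (lemma \<open>delay_factor_absorbed_by_step_size\<close>). Finally, the minimum of the objective gaps is at most
  their average with weights \<open>\<alpha> n\<close>.
\<close>

section \<open>Firmly nonexpansive maps\<close>

lemma firmly_nonexpansive_imp_nonexpansive:
  assumes "firmly_nonexpansive T"
  shows "norm (T u - T v) \<le> norm (u - v)"
proof -
  have "(norm (T u - T v))\<^sup>2 \<le> (T u - T v) \<bullet> (u - v)"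
    using assms by (simp add: firmly_nonexpansive_def)
  also have "\<dots> \<le> norm (T u - T v) * norm (u - v)"
    by (rule norm_cauchy_schwarz)
  finally have "norm (T u - T v) * norm (T u - T v) \<le> norm (T u - T v) * norm (u - v)"
    by (simp add: power2_eq_square)
  then show ?thesis
    by (cases "norm (T u - T v) = 0") (simp_all add: mult_le_cancel_left)
qed

lemma firmly_nonexpansive_dist_Fix:
  assumes "firmly_nonexpansive T" and "p \<in> Fix T"
  shows "(norm (T u - p))\<^sup>2 \<le> (norm (u - p))\<^sup>2 - (norm (T u - u))\<^sup>2"
proof -
  have "T p = p"
    using assms(2) by (simp add: Fix_def)
  then have "(norm (T u - p))\<^sup>2 \<le> (T u - p) \<bullet> (u - p)"
    using assms(1) unfolding firmly_nonexpansive_def by metis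
  moreover have "(norm (T u - u))\<^sup>2
      = (norm (T u - p))\<^sup>2 - 2 * ((T u - p) \<bullet> (u - p)) + (norm (u - p))\<^sup>2"
    by (simp add: power2_norm_eq_inner algebra_simps inner_commute)
  ultimately show ?thesis by simp
qed

section \<open>One step with an outdated subgradient\<close>

text \<open>
  The subgradient \<open>h\<close> at \<open>z\<close> compares \<open>p\<close> with \<open>z\<close>, and the subgradient \<open>h'\<close> at the new point
  compares \<open>z\<close> with the new point. Adding the two comparisons eliminates \<open>f z\<close>, so that, up to
  terms of order \<open>s\<^sup>2\<close>, the error comes only from the displacement \<open>y - z\<close>, and it is paired
  with \<open>h' - h\<close>, whose norm is at most \<open>2 * C\<close>.
\<close>

lemma outdated_subgradient_step:
  assumes h: "h \<in> subdifferential f z" "norm h \<le> C"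
    and h': "h' \<in> subdifferential f (y - s *\<^sub>R h)" "norm h' \<le> C"
    and s: "0 \<le> s"
  shows "(norm (y - s *\<^sub>R h - p))\<^sup>2 + 2 * s * (f (y - s *\<^sub>R h) - f p)
    \<le> (norm (y - p))\<^sup>2 + 4 * C * s * norm (y - z) + 3 * C\<^sup>2 * s\<^sup>2"
proof -
  define w where "w = y - s *\<^sub>R h"
  have C: "0 \<le> C"
    using h(2) norm_ge_zero order_trans by blast
  have fp: "h \<bullet> (p - z) \<le> f p - f z"
    using h(1) by (simp add: subdifferential_def)
  have fz: "h' \<bullet> (z - w) \<le> f z - f w"
    using h'(1) by (simp add: subdifferential_def w_def)
  have gap: "f w - f p \<le> h \<bullet> (z - p) + h' \<bullet> (w - z)"
    using fp fz by (simp add: inner_diff_right)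
  have displacement: "(h' - h) \<bullet> (y - z) \<le> 2 * C * norm (y - z)"
  proof -
    have "(h' - h) \<bullet> (y - z) \<le> norm (h' - h) * norm (y - z)"
      by (rule norm_cauchy_schwarz)
    also have "\<dots> \<le> (2 * C) * norm (y - z)"
      using norm_triangle_ineq4[of h' h] h(2) h'(2) by (intro mult_right_mono) auto
    finally show ?thesis .
  qed
  have cross: "- (h' \<bullet> h) \<le> C\<^sup>2"
  proof -
    have "- (h' \<bullet> h) \<le> norm h' * norm h"
      using Cauchy_Schwarz_ineq2[of h' h] by linarith
    also have "\<dots> \<le> C * C"
      using h(2) h'(2) C by (intro mult_mono) auto
    finally show ?thesis by (simp add: power2_eq_square)
  qed
  have hh: "h \<bullet> h \<le> C\<^sup>2"
    using power_mono[OF h(2) norm_ge_zero, of 2] by (simp add: power2_norm_eq_inner)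
  have expand: "(norm (w - p))\<^sup>2 = (norm (y - p))\<^sup>2 - 2 * s * (h \<bullet> (y - p)) + s\<^sup>2 * (h \<bullet> h)"
  proof -
    have "w - p = (y - p) - s *\<^sub>R h"
      by (simp add: w_def)
    moreover have "(norm (v - s *\<^sub>R h))\<^sup>2 = (norm v)\<^sup>2 - 2 * s * (h \<bullet> v) + s\<^sup>2 * (h \<bullet> h)" for v
      unfolding power2_norm_eq_inner
      by (simp add: inner_diff_left inner_diff_right inner_commute power2_eq_square)
    ultimately show ?thesis by metis
  qed
  have regroup: "h \<bullet> (z - p) + h' \<bullet> (w - z) - h \<bullet> (y - p) = (h' - h) \<bullet> (y - z) - s * (h' \<bullet> h)"
    unfolding w_def by (simp add: algebra_simps)
  have "(norm (w - p))\<^sup>2 + 2 * s * (f w - f p)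
      \<le> (norm (w - p))\<^sup>2 + 2 * s * (h \<bullet> (z - p) + h' \<bullet> (w - z))"
    using gap s by (simp add: mult_left_mono)
  also have "\<dots> = (norm (y - p))\<^sup>2
      + 2 * s * (h \<bullet> (z - p) + h' \<bullet> (w - z) - h \<bullet> (y - p)) + s\<^sup>2 * (h \<bullet> h)"
    unfolding expand by (simp add: algebra_simps)
  also have "\<dots> = (norm (y - p))\<^sup>2 + 2 * s * ((h' - h) \<bullet> (y - z))
      + 2 * s\<^sup>2 * (- (h' \<bullet> h)) + s\<^sup>2 * (h \<bullet> h)"
    unfolding regroup by (simp add: algebra_simps power2_eq_square)
  also have "\<dots> \<le> (norm (y - p))\<^sup>2 + 2 * s * (2 * C * norm (y - z))
      + 2 * s\<^sup>2 * C\<^sup>2 + s\<^sup>2 * C\<^sup>2"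
    using s by (intro add_mono mult_left_mono displacement cross hh order_refl) auto
  finally show ?thesis
    unfolding w_def by (simp add: algebra_simps)
qed

section \<open>The cost of the delay\<close>

text \<open>By exchanging the sums: each index \<open>k\<close> lies in the windows of at most \<open>w\<close> later indices \<open>n\<close>.\<close>

lemma sum_over_trailing_windows_le:
  fixes b :: "nat \<Rightarrow> real"
  assumes "\<And>k. 0 \<le> b k"
  shows "(\<Sum>n\<le>N. \<Sum>k\<in>{n - w..<n}. b k) \<le> real w * (\<Sum>k\<le>N. b k)"
proof -
  have "(\<Sum>n\<le>N. \<Sum>k\<in>{n - w..<n}. b k)
      = (\<Sum>n\<le>N. \<Sum>k\<in>{..N}. if k \<in> {n - w..<n} then b k else 0)"
  proof (rule sum.cong[OF refl])
    fix n assume "n \<in> {..N}"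
    then have "{n - w..<n} = {..N} \<inter> {n - w..<n}" by auto
    then show "(\<Sum>k\<in>{n - w..<n}. b k) = (\<Sum>k\<in>{..N}. if k \<in> {n - w..<n} then b k else 0)"
      by (metis finite_atMost sum.inter_restrict)
  qed
  also have "\<dots> = (\<Sum>k\<le>N. \<Sum>n\<le>N. if k \<in> {n - w..<n} then b k else 0)"
    by (rule sum.swap)
  also have "\<dots> \<le> (\<Sum>k\<le>N. real w * b k)"
  proof (rule sum_mono)
    fix k
    have "(\<Sum>n\<le>N. if k \<in> {n - w..<n} then b k else 0)
        = real (card {n \<in> {..N}. k \<in> {n - w..<n}}) * b k"
      by (simp flip: sum.inter_filter)
    also have "\<dots> \<le> real w * b k"
    proof (intro mult_right_mono assms)
      have "{n \<in> {..N}. k \<in> {n - w..<n}} \<subseteq> {k<..k + w}" by auto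
      then have "card {n \<in> {..N}. k \<in> {n - w..<n}} \<le> card {k<..k + w}"
        by (intro card_mono) auto
      then show "real (card {n \<in> {..N}. k \<in> {n - w..<n}}) \<le> real w" by simp
    qed
    finally show "(\<Sum>n\<le>N. if k \<in> {n - w..<n} then b k else 0) \<le> real w * b k" .
  qed
  finally show ?thesis by (simp add: sum_distrib_left)
qed

lemma image_displacement_le:
  assumes T: "firmly_nonexpansive T"
    and step: "\<And>n. u (Suc n) = T (u n) - \<alpha> n *\<^sub>R h n"
    and h: "\<And>n. norm (h n) \<le> C"
    and \<alpha>: "\<And>n. 0 \<le> \<alpha> n"
    and "m \<le> n"
  shows "norm (T (u n) - T (u m)) \<le> (\<Sum>k\<in>{m..<n}. norm (T (u k) - u k) + C * \<alpha> k)"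
  using \<open>m \<le> n\<close>
proof (induction n rule: dec_induct)
  case base
  then show ?case by simp
next
  case (step n)
  have "norm (T (u (Suc n)) - T (u n)) \<le> norm (u (Suc n) - u n)"
    by (rule firmly_nonexpansive_imp_nonexpansive[OF T])
  also have "u (Suc n) - u n = (T (u n) - u n) - \<alpha> n *\<^sub>R h n"
    by (simp add: assms(2))
  also have "norm \<dots> \<le> norm (T (u n) - u n) + norm (\<alpha> n *\<^sub>R h n)"
    by (rule norm_triangle_ineq4)
  also have "\<dots> \<le> norm (T (u n) - u n) + C * \<alpha> n"
    using mult_left_mono[OF h[of n] \<alpha>[of n]] \<alpha>[of n] by (simp add: mult.commute)
  finally have "norm (T (u (Suc n)) - T (u n)) \<le> norm (T (u n) - u n) + C * \<alpha> n" .
  moreover have "norm (T (u (Suc n)) - T (u m))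
      \<le> norm (T (u (Suc n)) - T (u n)) + norm (T (u n) - T (u m))"
    using norm_triangle_ineq[of "T (u (Suc n)) - T (u n)" "T (u n) - T (u m)"] by simp
  ultimately show ?case
    using step by simp
qed

text \<open>
  The weights in Young's inequality are chosen so that summation over all \<open>n\<close> charges
  \<open>(norm (T (u k) - u k))\<^sup>2\<close> at most \<open>\<tau>\<close> times with weight \<open>1 / (\<tau> + 1)\<close>. Monotonicity of \<open>\<alpha>\<close>
  bounds \<open>\<alpha> n * \<alpha> k\<close> by \<open>(\<alpha> k)\<^sup>2\<close>.
\<close>

lemma delay_error_le:
  fixes r \<alpha> :: "nat \<Rightarrow> real" and \<tau> :: nat
  defines "L \<equiv> real \<tau> + 1"
  assumes \<alpha>: "\<And>n. 0 \<le> \<alpha> n" "decseq \<alpha>" and "0 \<le> C"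
  shows "4 * C * \<alpha> n * (\<Sum>k\<in>{n - \<tau>..<n}. r k + C * \<alpha> k)
    \<le> (\<Sum>k\<in>{n - \<tau>..<n}. (r k)\<^sup>2 / L + 4 * C\<^sup>2 * (\<alpha> k)\<^sup>2) + 4 * C\<^sup>2 * L\<^sup>2 * (\<alpha> n)\<^sup>2"
proof -
  have L: "0 < L" by (simp add: L_def)
  have young: "4 * C * \<alpha> n * (r k + C * \<alpha> k)
      \<le> (r k)\<^sup>2 / L + 4 * C\<^sup>2 * (\<alpha> k)\<^sup>2 + 4 * C\<^sup>2 * L * (\<alpha> n)\<^sup>2" if "k < n" for k
  proof -
    have "0 \<le> (r k - 2 * C * L * \<alpha> n)\<^sup>2 / L"
      using L by simp
    also have "\<dots> = (r k)\<^sup>2 / L + 4 * C\<^sup>2 * L * (\<alpha> n)\<^sup>2 - 4 * C * \<alpha> n * r k"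
      using L by (simp add: field_simps power2_eq_square)
    finally have r: "4 * C * \<alpha> n * r k \<le> (r k)\<^sup>2 / L + 4 * C\<^sup>2 * L * (\<alpha> n)\<^sup>2" by simp
    have "\<alpha> n * \<alpha> k \<le> \<alpha> k * \<alpha> k"
      using \<alpha>(1) decseqD[OF \<alpha>(2)] that by (intro mult_right_mono) auto
    then have "4 * C\<^sup>2 * (\<alpha> n * \<alpha> k) \<le> 4 * C\<^sup>2 * (\<alpha> k * \<alpha> k)"
      by (intro mult_left_mono) auto
    then show ?thesis
      using r by (simp add: algebra_simps power2_eq_square)
  qed
  have "4 * C * \<alpha> n * (\<Sum>k\<in>{n - \<tau>..<n}. r k + C * \<alpha> k)
      = (\<Sum>k\<in>{n - \<tau>..<n}. 4 * C * \<alpha> n * (r k + C * \<alpha> k))"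
    by (rule sum_distrib_left)
  also have "\<dots> \<le> (\<Sum>k\<in>{n - \<tau>..<n}.
      (r k)\<^sup>2 / L + 4 * C\<^sup>2 * (\<alpha> k)\<^sup>2 + 4 * C\<^sup>2 * L * (\<alpha> n)\<^sup>2)"
    by (intro sum_mono young) simp
  also have "\<dots> = (\<Sum>k\<in>{n - \<tau>..<n}. (r k)\<^sup>2 / L + 4 * C\<^sup>2 * (\<alpha> k)\<^sup>2)
      + real (card {n - \<tau>..<n}) * (4 * C\<^sup>2 * L * (\<alpha> n)\<^sup>2)"
    by (simp add: sum.distrib)
  also have "\<dots> \<le> (\<Sum>k\<in>{n - \<tau>..<n}. (r k)\<^sup>2 / L + 4 * C\<^sup>2 * (\<alpha> k)\<^sup>2)
      + L * (4 * C\<^sup>2 * L * (\<alpha> n)\<^sup>2)"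
    using L by (intro add_left_mono mult_right_mono) (auto simp: L_def)
  also have "L * (4 * C\<^sup>2 * L * (\<alpha> n)\<^sup>2) = 4 * C\<^sup>2 * L\<^sup>2 * (\<alpha> n)\<^sup>2"
    by (simp add: power2_eq_square)
  finally show ?thesis .
qed

lemma summed_delay_error_le:
  fixes r \<alpha> :: "nat \<Rightarrow> real" and \<tau> :: nat
  defines "L \<equiv> real \<tau> + 1"
  assumes \<alpha>: "\<And>n. 0 \<le> \<alpha> n" "decseq \<alpha>" and "0 \<le> C"
  shows "(\<Sum>n\<le>N. 4 * C * \<alpha> n * (\<Sum>k\<in>{n - \<tau>..<n}. r k + C * \<alpha> k))
    \<le> (\<Sum>n\<le>N. (r n)\<^sup>2) + C\<^sup>2 * (4 * L\<^sup>2 + 4 * L) * (\<Sum>n\<le>N. (\<alpha> n)\<^sup>2)"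
proof -
  have L: "0 < L" "real \<tau> \<le> L" by (simp_all add: L_def)
  define b where "b k = (r k)\<^sup>2 / L + 4 * C\<^sup>2 * (\<alpha> k)\<^sup>2" for k
  have b: "0 \<le> b k" for k
    using L by (simp add: b_def)
  have "(\<Sum>n\<le>N. 4 * C * \<alpha> n * (\<Sum>k\<in>{n - \<tau>..<n}. r k + C * \<alpha> k))
      \<le> (\<Sum>n\<le>N. (\<Sum>k\<in>{n - \<tau>..<n}. b k) + 4 * C\<^sup>2 * L\<^sup>2 * (\<alpha> n)\<^sup>2)"
    unfolding b_def L_def by (intro sum_mono delay_error_le assms)
  also have "\<dots> = (\<Sum>n\<le>N. \<Sum>k\<in>{n - \<tau>..<n}. b k) + 4 * C\<^sup>2 * L\<^sup>2 * (\<Sum>n\<le>N. (\<alpha> n)\<^sup>2)"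
    by (simp add: sum.distrib sum_distrib_left)
  also have "(\<Sum>n\<le>N. \<Sum>k\<in>{n - \<tau>..<n}. b k) \<le> L * (\<Sum>k\<le>N. b k)"
    using sum_over_trailing_windows_le[of b \<tau> N, OF b] L(2)
      mult_right_mono[OF L(2) sum_nonneg[of "{..N}" b]] b by fastforce
  also have "L * (\<Sum>k\<le>N. b k) = (\<Sum>k\<le>N. (r k)\<^sup>2) + 4 * C\<^sup>2 * L * (\<Sum>k\<le>N. (\<alpha> k)\<^sup>2)"
  proof -
    have "L * (\<Sum>k\<le>N. b k) = (\<Sum>k\<le>N. (r k)\<^sup>2 + 4 * C\<^sup>2 * L * (\<alpha> k)\<^sup>2)"
      using L by (simp add: sum_distrib_left b_def distrib_left mult_ac)
    then show ?thesis by (simp add: sum.distrib sum_distrib_left)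
  qed
  finally show ?thesis by (simp add: algebra_simps)
qed

section \<open>The summed objective gap\<close>

text \<open>
  Here \<open>m n\<close> is the index of the point at which the subgradient of step \<open>n\<close> was computed. The
  decreases \<open>(norm (T (u n) - u n))\<^sup>2\<close> granted by firm nonexpansiveness cancel the
  same squares in the summed delay error.
\<close>

lemma summed_objective_gap_le:
  fixes \<tau> :: nat
  defines "L \<equiv> real \<tau> + 1"
  assumes T: "firmly_nonexpansive T" and p: "p \<in> Fix T"
    and g: "\<And>v. g v \<in> subdifferential f v"
    and \<alpha>: "\<And>n. 0 \<le> \<alpha> n" "decseq \<alpha>"
    and m: "\<And>n. n - \<tau> \<le> m n" "\<And>n. m n \<le> n"
    and step: "\<And>n. u (Suc n) = T (u n) - \<alpha> n *\<^sub>R g (T (u (m n)))"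
    and bound: "\<And>n. norm (g (u n)) \<le> C" "\<And>n. norm (g (T (u n))) \<le> C"
  shows "(\<Sum>n\<le>N. 2 * \<alpha> n * (f (u (Suc n)) - f p))
    \<le> (norm (u 0 - p))\<^sup>2 + C\<^sup>2 * (4 * L\<^sup>2 + 4 * L + 3) * (\<Sum>n\<le>N. (\<alpha> n)\<^sup>2)"
proof -
  define r where "r n = norm (T (u n) - u n)" for n
  define D where "D n = (norm (u n - p))\<^sup>2" for n
  define E where "E n = 4 * C * \<alpha> n * (\<Sum>k\<in>{n - \<tau>..<n}. r k + C * \<alpha> k)" for n
  have C: "0 \<le> C"
    using bound(1)[of 0] norm_ge_zero order_trans by blast
  have one_step: "2 * \<alpha> n * (f (u (Suc n)) - f p)
      \<le> D n - D (Suc n) - (r n)\<^sup>2 + E n + 3 * C\<^sup>2 * (\<alpha> n)\<^sup>2" for n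
  proof -
    have "D (Suc n) + 2 * \<alpha> n * (f (u (Suc n)) - f p)
        \<le> (norm (T (u n) - p))\<^sup>2 + 4 * C * \<alpha> n * norm (T (u n) - T (u (m n))) + 3 * C\<^sup>2 * (\<alpha> n)\<^sup>2"
      unfolding D_def step
      by (rule outdated_subgradient_step[OF g bound(2) g _ \<alpha>(1)])
        (use bound(1)[of "Suc n"] in \<open>simp add: step\<close>)
    moreover have "(norm (T (u n) - p))\<^sup>2 \<le> D n - (r n)\<^sup>2"
      unfolding D_def r_def by (rule firmly_nonexpansive_dist_Fix[OF T p])
    moreover have "4 * C * \<alpha> n * norm (T (u n) - T (u (m n))) \<le> E n"
      unfolding E_def
    proof (intro mult_left_mono)
      have "norm (T (u n) - T (u (m n))) \<le> (\<Sum>k\<in>{m n..<n}. r k + C * \<alpha> k)"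
        unfolding r_def
        by (rule image_displacement_le[where h = "\<lambda>n. g (T (u (m n)))", OF T step bound(2) \<alpha>(1) m(2)])
      also have "\<dots> \<le> (\<Sum>k\<in>{n - \<tau>..<n}. r k + C * \<alpha> k)"
        using m(1)[of n] \<alpha>(1) C by (intro sum_mono2) (auto simp: r_def)
      finally show "norm (T (u n) - T (u (m n))) \<le> (\<Sum>k\<in>{n - \<tau>..<n}. r k + C * \<alpha> k)" .
    qed (use C \<alpha>(1) in simp)
    ultimately show ?thesis by linarith
  qed
  have "(\<Sum>n\<le>N. 2 * \<alpha> n * (f (u (Suc n)) - f p))
      \<le> (\<Sum>n\<le>N. D n - D (Suc n) - (r n)\<^sup>2 + E n + 3 * C\<^sup>2 * (\<alpha> n)\<^sup>2)"
    by (intro sum_mono one_step)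
  also have "\<dots> = (\<Sum>n\<le>N. D n - D (Suc n)) - (\<Sum>n\<le>N. (r n)\<^sup>2) + (\<Sum>n\<le>N. E n)
      + 3 * C\<^sup>2 * (\<Sum>n\<le>N. (\<alpha> n)\<^sup>2)"
    by (simp add: sum.distrib sum_subtractf sum_distrib_left)
  also have "(\<Sum>n\<le>N. D n - D (Suc n)) = D 0 - D (Suc N)"
    by (rule sum_telescope)
  finally have "(\<Sum>n\<le>N. 2 * \<alpha> n * (f (u (Suc n)) - f p))
      \<le> D 0 - D (Suc N) - (\<Sum>n\<le>N. (r n)\<^sup>2) + (\<Sum>n\<le>N. E n) + 3 * C\<^sup>2 * (\<Sum>n\<le>N. (\<alpha> n)\<^sup>2)" .
  moreover have "(\<Sum>n\<le>N. E n)
      \<le> (\<Sum>n\<le>N. (r n)\<^sup>2) + C\<^sup>2 * (4 * L\<^sup>2 + 4 * L) * (\<Sum>n\<le>N. (\<alpha> n)\<^sup>2)"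
    unfolding E_def L_def by (rule summed_delay_error_le[OF \<alpha> C])
  moreover have "0 \<le> D (Suc N)"
    by (simp add: D_def)
  ultimately have "(\<Sum>n\<le>N. 2 * \<alpha> n * (f (u (Suc n)) - f p))
      \<le> D 0 + C\<^sup>2 * (4 * L\<^sup>2 + 4 * L) * (\<Sum>n\<le>N. (\<alpha> n)\<^sup>2) + 3 * C\<^sup>2 * (\<Sum>n\<le>N. (\<alpha> n)\<^sup>2)"
    by linarith
  also have "\<dots> = D 0 + C\<^sup>2 * (4 * L\<^sup>2 + 4 * L + 3) * (\<Sum>n\<le>N. (\<alpha> n)\<^sup>2)"
    by (simp add: algebra_simps)
  finally show ?thesis
    by (simp add: D_def)
qed

section \<open>Step sizes and the convergence rate\<close>

text \<open>
  The constant \<open>40\<close> is \<open>5 * 8\<close>: the polynomial \<open>4 * L\<^sup>2 + 4 * L + 1\<close> is at most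
  \<open>5 * (3 + 2 * L\<^sup>2)\<close>, and one factor \<open>\<alpha> n powr a \<le> \<alpha> 0 powr a\<close> can be split off \<open>(\<alpha> n)\<^sup>2\<close>.
\<close>

lemma delay_factor_absorbed_by_step_size:
  fixes L a :: real
  assumes \<alpha>: "\<And>n. 0 < \<alpha> n" "decseq \<alpha>" and a: "0 \<le> a"
    and small: "(3 + 2 * L\<^sup>2) * \<alpha> 0 powr a \<le> 8"
  shows "(4 * L\<^sup>2 + 4 * L + 1) * (\<alpha> n)\<^sup>2 \<le> 40 * \<alpha> n powr (2 - a)"
proof -
  have "0 \<le> 4 * L\<^sup>2 + 2 * (L - 1)\<^sup>2" by simp
  then have L: "4 * L\<^sup>2 + 4 * L + 1 \<le> 5 * (3 + 2 * L\<^sup>2)"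
    by (simp add: power2_eq_square algebra_simps)
  have split: "(\<alpha> n)\<^sup>2 = \<alpha> n powr a * \<alpha> n powr (2 - a)"
    using \<alpha>(1)[of n] by (simp flip: powr_add)
  have "\<alpha> n powr a \<le> \<alpha> 0 powr a"
    using \<alpha>(1)[of n] decseqD[OF \<alpha>(2)] a by (intro powr_mono2) auto
  then have "(4 * L\<^sup>2 + 4 * L + 1) * \<alpha> n powr a \<le> 5 * (3 + 2 * L\<^sup>2) * \<alpha> 0 powr a"
    using L by (intro mult_mono) auto
  also have "\<dots> \<le> 40"
    using small unfolding mult.assoc by linarith
  finally show ?thesis
    unfolding split by (simp add: mult_right_mono flip: mult.assoc)
qed

lemma optimal_value_eq:
  fixes f :: "'a \<Rightarrow> real"
  assumes "p \<in> solution_set f T"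
  shows "optimal_value f T = f p"
  using assms unfolding solution_set_def optimal_value_def
  by (intro cInf_eq_minimum) (auto simp: is_arg_min_linorder)

lemma Min_le_weighted_average:
  fixes w c :: "'a \<Rightarrow> real"
  assumes "finite A" "A \<noteq> {}" and w: "\<And>i. i \<in> A \<Longrightarrow> 0 < w i"
  shows "Min (c ` A) \<le> (\<Sum>i\<in>A. w i * c i) / (\<Sum>i\<in>A. w i)"
proof -
  have "Min (c ` A) * (\<Sum>i\<in>A. w i) = (\<Sum>i\<in>A. w i * Min (c ` A))"
    by (simp add: sum_distrib_right mult.commute)
  also have "\<dots> \<le> (\<Sum>i\<in>A. w i * c i)"
    using assms by (intro sum_mono mult_left_mono) (auto simp: less_imp_le)
  finally show ?thesis
    using sum_pos[OF assms(1,2) w] by (simp add: pos_le_divide_eq)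
qed

theorem theorem3p5:
  fixes f :: "real ^ 'd \<Rightarrow> real"
    and T :: "real ^ 'd \<Rightarrow> real ^ 'd"
    and g :: "real ^ 'd \<Rightarrow> real ^ 'd"
    and a C :: real
    and \<tau> :: nat
    and delay :: "nat \<Rightarrow> nat"
    and \<alpha> :: "nat \<Rightarrow> real"
    and x :: "int \<Rightarrow> real ^ 'd"
  assumes "convex_on UNIV f"
    and "firmly_nonexpansive T"
    and "Fix T \<noteq> {}"
    and "solution_set f T \<noteq> {}"
    and subgradient: "\<And>u. g u \<in> subdifferential f u"
    and "0 < a" "a < 1"
    and "\<And>n. delay n \<le> \<tau>"
    and "\<And>n. 0 < \<alpha> n"
    and "decseq \<alpha>"
    and "(3 + 2 * (real \<tau> + 1)\<^sup>2) * \<alpha> 0 powr a < 8"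
    and "fp_delayed_subgradient T g \<tau> delay \<alpha> x"
    and "C > 0"
    and "\<And>n::nat. max (norm (g (x (int n)))) (norm (g (T (x (int n))))) \<le> C"
  shows "\<forall>N::nat. \<forall>xstar \<in> solution_set f T.
    (MIN n\<in>{0..N}. f (x (int n + 1))) - optimal_value f T
      \<le> ((norm (x 0 - xstar))\<^sup>2 + 2 * C\<^sup>2 * (\<Sum>n=0..N. (\<alpha> n)\<^sup>2)
            + 40 * C\<^sup>2 * (\<Sum>n=0..N. \<alpha> n powr (2 - a)))
          / (2 * (\<Sum>n=0..N. \<alpha> n))"
proof (intro allI ballI)
  fix N :: nat and p
  assume p: "p \<in> solution_set f T"
  define L where "L = real \<tau> + 1"
  define u where "u n = x (int n)" for n
  define m where "m n = n - delay n" for n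
  define S where "S = (\<Sum>n\<le>N. (\<alpha> n)\<^sup>2)"
  define R where "R = (\<Sum>n\<le>N. \<alpha> n powr (2 - a))"
  define A where "A = (\<Sum>n\<le>N. \<alpha> n)"
  have \<alpha>: "0 \<le> \<alpha> n" for n
    using \<open>\<And>n. 0 < \<alpha> n\<close> less_imp_le by blast
  have A: "0 < A"
    unfolding A_def using \<open>\<And>n. 0 < \<alpha> n\<close> by (intro sum_pos) auto
  have Fix: "p \<in> Fix T"
    using p by (simp add: solution_set_def is_arg_min_def)
  have f_opt: "optimal_value f T = f p"
    by (rule optimal_value_eq[OF p])
  \<comment> \<open>All initial values agree, so a negative index can be replaced by \<open>0\<close>, which is what the
    truncated subtraction in \<open>m\<close> does.\<close>
  have delayed: "x (int n - int (delay n)) = u (m n)" for n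
  proof (cases "delay n \<le> n")
    case True
    then show ?thesis by (simp add: u_def m_def of_nat_diff)
  next
    case False
    then have "int n - int (delay n) \<in> {- int \<tau>..0}"
      using \<open>\<And>n. delay n \<le> \<tau>\<close>[of n] by simp
    then have "x (int n - int (delay n)) = x 0"
      using \<open>fp_delayed_subgradient T g \<tau> delay \<alpha> x\<close> unfolding fp_delayed_subgradient_def by blast
    then show ?thesis
      using False by (simp add: u_def m_def)
  qed
  have step: "u (Suc n) = T (u n) - \<alpha> n *\<^sub>R g (T (u (m n)))" for n
    using \<open>fp_delayed_subgradient T g \<tau> delay \<alpha> x\<close>
    unfolding fp_delayed_subgradient_def
    by (metis delayed u_def of_nat_Suc add.commute)
  have bound: "norm (g (u n)) \<le> C" "norm (g (T (u n))) \<le> C" for n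
    using assms(14)[of n] by (simp_all add: u_def)
  have "(\<Sum>n\<le>N. 2 * \<alpha> n * (f (u (Suc n)) - f p))
      \<le> (norm (u 0 - p))\<^sup>2 + C\<^sup>2 * (4 * L\<^sup>2 + 4 * L + 3) * S"
    unfolding S_def L_def
    by (rule summed_objective_gap_le[OF \<open>firmly_nonexpansive T\<close> Fix subgradient \<alpha>
          \<open>decseq \<alpha>\<close> _ _ step bound])
      (use \<open>\<And>n. delay n \<le> \<tau>\<close> in \<open>auto simp: m_def intro: diff_le_mono2\<close>)
  also have "\<dots> = (norm (u 0 - p))\<^sup>2 + 2 * C\<^sup>2 * S + C\<^sup>2 * ((4 * L\<^sup>2 + 4 * L + 1) * S)"
    by (simp add: algebra_simps)
  also have "C\<^sup>2 * ((4 * L\<^sup>2 + 4 * L + 1) * S) \<le> C\<^sup>2 * (40 * R)"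
    unfolding S_def R_def sum_distrib_left
    using assms(11) \<open>0 < a\<close> \<open>decseq \<alpha>\<close> \<open>\<And>n. 0 < \<alpha> n\<close>
    by (intro mult_left_mono sum_mono delay_factor_absorbed_by_step_size) (auto simp: L_def)
  finally have gap: "(\<Sum>n\<le>N. 2 * \<alpha> n * (f (u (Suc n)) - f p))
      \<le> (norm (u 0 - p))\<^sup>2 + 2 * C\<^sup>2 * S + 40 * C\<^sup>2 * R"
    by (simp add: mult_ac)
  have "(MIN n\<in>{..N}. f (u (Suc n))) \<le> (\<Sum>n\<le>N. \<alpha> n * f (u (Suc n))) / A"
    unfolding A_def using \<open>\<And>n. 0 < \<alpha> n\<close> by (intro Min_le_weighted_average) auto
  moreover have "(\<Sum>n\<le>N. 2 * \<alpha> n * (f (u (Suc n)) - f p))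
      = 2 * (\<Sum>n\<le>N. \<alpha> n * f (u (Suc n))) - 2 * A * f p"
    by (simp add: A_def sum_distrib_left sum_distrib_right right_diff_distrib sum_subtractf mult_ac)
  ultimately have "(MIN n\<in>{..N}. f (u (Suc n))) - f p
      \<le> (\<Sum>n\<le>N. 2 * \<alpha> n * (f (u (Suc n)) - f p)) / (2 * A)"
    using A by (simp add: field_simps)
  also have "\<dots> \<le> ((norm (u 0 - p))\<^sup>2 + 2 * C\<^sup>2 * S + 40 * C\<^sup>2 * R) / (2 * A)"
    using gap A by (intro divide_right_mono) auto
  finally show "(MIN n\<in>{0..N}. f (x (int n + 1))) - optimal_value f T
      \<le> ((norm (x 0 - p))\<^sup>2 + 2 * C\<^sup>2 * (\<Sum>n=0..N. (\<alpha> n)\<^sup>2)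
            + 40 * C\<^sup>2 * (\<Sum>n=0..N. \<alpha> n powr (2 - a)))
          / (2 * (\<Sum>n=0..N. \<alpha> n))"
    unfolding f_opt u_def A_def S_def R_def by (simp add: atLeast0AtMost add.commute)
qed

end
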